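(* A graph $G=(V,E)$ with $V=\{v_1,\ldots,v_n\}$ (where $n\ge 1$) is total domishold if and only if its neighborhood function $f_G$ is threshold. Moreover, if $(w_1,\ldots,w_n,t)$ is an integral separating structure of $f_G$, then $(w,\sum_{i=1}^n w_i-t)$ with $w(v_i)=w_i$ for all $i\in\{1,\ldots,n\}$ is a total domishold structure of $G$.
   Context: Graphs are finite, simple and undirected; $N_G(v)$ is the open neighborhood of $v$; $\mathbb{R}_+$ is the set of non-negative reals. A total dominating set in $G=(V,E)$ is a set $D\subseteq V$ such that every vertex of $G$ has a neighbor in $D$. $G$ is total domishold if there exists a pair $(w,t)$ with $w:V\to\mathbb{R}_+$, $t\in\mathbb{R}_+$ such that for every $S\subseteq V$, $\sum_{x\in S}w(x)\ge t$ if and only if $S$ is a total dominating set in $G$; such a pair is a total domishold structure of $G$. Graphs with isolated vertices are allowed. The neighborhood function of $G$ is the positive (monotone) Boolean function $f_G:\{0,1\}^V\to\{0,1\}$, $f_G(x)=\bigvee_{v\in V}\bigwedge_{u\in N_G(v)}x_u$ (an empty conjunction equals $1$); the coordinate of $x$ corresponding to $v_i$ is denoted $x_i$. A positive Boolean function $f:\{0,1\}^n\to\{0,1\}$ is threshold if there exist non-negative real weights $w_1,\ldots,w_n$ and a real number $t$ such that for every $x\in\{0,1\}^n$, $f(x)=0$ if and only if $\sum_{i=1}^n w_ix_i\le t$; then $(w_1,\ldots,w_n,t)$ is a separating structure of $f$, called integral if all $w_i$ and $t$ are integers. *)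

theory Defs
  imports Complex_Main "HOL-Library.FuncSet" "Graph_Theory.Digraph"
begin

(* A finite simple undirected graph is a digraph satisfying the predicate "graph" of
   Graph_Theory.Digraph (finite, loop-free, no parallel arcs, symmetric): an edge uv is the
   pair of opposite arcs from u to v and from v to u. Isolated vertices are allowed. *)

section \<open>Total domination\<close>

definition open_neighborhood :: "('a, 'b) pre_digraph \<Rightarrow> 'a \<Rightarrow> 'a set" where
  "open_neighborhood G v = {u \<in> verts G. (v, u) \<in> arcs_ends G}"

definition total_dominating_set :: "('a, 'b) pre_digraph \<Rightarrow> 'a set \<Rightarrow> bool" where
  "total_dominating_set G D \<longleftrightarrow>
     D \<subseteq> verts G \<and> (\<forall>v \<in> verts G. \<exists>u \<in> D. u \<in> open_neighborhood G v)"

definition total_domishold_structure ::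
    "('a, 'b) pre_digraph \<Rightarrow> ('a \<Rightarrow> real) \<Rightarrow> real \<Rightarrow> bool" where
  "total_domishold_structure G w t \<longleftrightarrow>
     (\<forall>x \<in> verts G. 0 \<le> w x) \<and> 0 \<le> t \<and>
     (\<forall>S. S \<subseteq> verts G \<longrightarrow> (t \<le> (\<Sum>x\<in>S. w x) \<longleftrightarrow> total_dominating_set G S))"

definition total_domishold :: "('a, 'b) pre_digraph \<Rightarrow> bool" where
  "total_domishold G \<longleftrightarrow> (\<exists>w t. total_domishold_structure G w t)"

section \<open>Boolean functions\<close>

(* The values 0 and 1 are False and True. The cube {0,1}^I consists of the functions to bool
   that are extensional on I, so that it is in bijection with the assignments on I. *)

definition bool_cube :: "'i set \<Rightarrow> ('i \<Rightarrow> bool) set" where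
  "bool_cube I = (I \<rightarrow>\<^sub>E UNIV)"

definition positive_on_cube :: "nat \<Rightarrow> ((nat \<Rightarrow> bool) \<Rightarrow> bool) \<Rightarrow> bool" where
  "positive_on_cube n f \<longleftrightarrow> mono_on (bool_cube {1..n}) f"

(* t may be negative; this happens exactly when f is constantly 1. *)
definition separating_structure ::
    "nat \<Rightarrow> ((nat \<Rightarrow> bool) \<Rightarrow> bool) \<Rightarrow> (nat \<Rightarrow> real) \<Rightarrow> real \<Rightarrow> bool" where
  "separating_structure n f w t \<longleftrightarrow>
     (\<forall>i \<in> {1..n}. 0 \<le> w i) \<and>
     (\<forall>x \<in> bool_cube {1..n}. \<not> f x \<longleftrightarrow> (\<Sum>i=1..n. w i * of_bool (x i)) \<le> t)"

definition integral_structure :: "nat \<Rightarrow> (nat \<Rightarrow> real) \<Rightarrow> real \<Rightarrow> bool" where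
  "integral_structure n w t \<longleftrightarrow> (\<forall>i \<in> {1..n}. w i \<in> \<int>) \<and> t \<in> \<int>"

definition threshold_function :: "nat \<Rightarrow> ((nat \<Rightarrow> bool) \<Rightarrow> bool) \<Rightarrow> bool" where
  "threshold_function n f \<longleftrightarrow>
     positive_on_cube n f \<and> (\<exists>w t. separating_structure n f w t)"

section \<open>The neighborhood function\<close>

definition neighborhood_function :: "('a, 'b) pre_digraph \<Rightarrow> ('a \<Rightarrow> bool) \<Rightarrow> bool" where
  "neighborhood_function G x \<longleftrightarrow> (\<exists>v \<in> verts G. \<forall>u \<in> open_neighborhood G v. x u)"

(* For an enumeration v 1, ..., v n of the index set of f, the function f read as a function
   on {0,1}^n: the coordinate of the argument at v i is x i. *)
definition in_coordinates ::
    "nat \<Rightarrow> (nat \<Rightarrow> 'a) \<Rightarrow> (('a \<Rightarrow> bool) \<Rightarrow> bool) \<Rightarrow> (nat \<Rightarrow> bool) \<Rightarrow> bool" where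
  "in_coordinates n v f x =
     f (\<lambda>u \<in> v ` {1..n}. x (inv_into {1..n} v u))"

lemma neighborhood_function_in_coordinates:
  assumes "bij_betw v {1..n} (verts G)"
  shows "in_coordinates n v (neighborhood_function G) x \<longleftrightarrow>
    (\<exists>j \<in> {1..n}. \<forall>i \<in> {1..n}. v i \<in> open_neighborhood G (v j) \<longrightarrow> x i)"
proof -
  have V: "verts G = v ` {1..n}" and inj: "inj_on v {1..n}"
    using assms by (auto simp: bij_betw_def)
  have inv: "inv_into {1..n} v (v i) = i" if "i \<in> {1..n}" for i
    using inj that by (rule inv_into_f_f)
  have "(\<forall>u \<in> open_neighborhood G (v j). (\<lambda>u \<in> v ` {1..n}. x (inv_into {1..n} v u)) u) \<longleftrightarrow>
      (\<forall>i \<in> {1..n}. v i \<in> open_neighborhood G (v j) \<longrightarrow> x i)" for j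
  proof -
    have "open_neighborhood G (v j) \<subseteq> v ` {1..n}"
      by (auto simp: open_neighborhood_def V)
    then show ?thesis using inv by (auto 0 4 dest: subsetD)
  qed
  then show ?thesis
    by (simp add: in_coordinates_def neighborhood_function_def V)
qed

lemma neighborhood_function_positive:
  assumes "bij_betw v {1..n} (verts G)"
  shows "positive_on_cube n (in_coordinates n v (neighborhood_function G))"
  unfolding positive_on_cube_def
  by (intro mono_onI)
    (fastforce simp: le_fun_def neighborhood_function_in_coordinates[OF assms])

end

theory Submission
  imports Defs
begin

text \<open>
  The bridge between the two notions is complementation. A vector \<open>x\<close> of the cube selects a set of
  vertices; let \<open>S\<close> be the set of the vertices that it does not select. The neighborhood function
  is 1 at \<open>x\<close> iff \<open>x\<close> selects all of some neighborhood, that is, iff \<open>S\<close> misses a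
  neighborhood, that is, iff \<open>S\<close> is not total dominating. Complementation turns a weight \<open>s\<close> into
  \<open>W - s\<close>, where \<open>W\<close> is the total weight, so the condition ``weight of \<open>x\<close> at most \<open>t\<close>'' becomes
  ``weight of \<open>S\<close> at least \<open>W - t\<close>''. Hence separating structures with threshold \<open>t\<close> and total
  domishold structures with threshold \<open>W - t\<close> are the same thing
  (\<open>separating_structure_iff_total_domishold_structure\<close>), and both parts of the theorem follow.

  The correspondence has one point that is not formal: a total domishold structure needs a
  non-negative threshold. This holds because the graph has a vertex: the all-ones vector then
  selects a whole neighborhood, so \<open>W\<close> exceeds \<open>t\<close>.
\<close>

definition unselected :: "nat \<Rightarrow> (nat \<Rightarrow> 'a) \<Rightarrow> (nat \<Rightarrow> bool) \<Rightarrow> 'a set" where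
  "unselected n v x = v ` {i \<in> {1..n}. \<not> x i}"

text \<open>Each vertex set is the complement of a point of the cube, so that a condition on all subsets
  is a condition on all points.\<close>

lemma all_subsets_iff_all_cube:
  "(\<forall>S \<subseteq> v ` {1..n}. P S) \<longleftrightarrow> (\<forall>x \<in> bool_cube {1..n}. P (unselected n v x))"
proof (intro iffI allI impI ballI)
  fix x
  assume "\<forall>S \<subseteq> v ` {1..n}. P S"
  moreover have "unselected n v x \<subseteq> v ` {1..n}"
    by (auto simp: unselected_def)
  ultimately show "P (unselected n v x)"
    by blast
next
  fix S
  assume *: "\<forall>x \<in> bool_cube {1..n}. P (unselected n v x)" and S: "S \<subseteq> v ` {1..n}"
  have "unselected n v (\<lambda>i \<in> {1..n}. v i \<notin> S) = S"
    using S by (auto simp: unselected_def)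
  moreover have "(\<lambda>i \<in> {1..n}. v i \<notin> S) \<in> bool_cube {1..n}"
    by (simp add: bool_cube_def)
  ultimately show "P S"
    using * by metis
qed

lemma total_dominating_unselected_iff:
  assumes "bij_betw v {1..n} (verts G)"
  shows "total_dominating_set G (unselected n v x) \<longleftrightarrow>
    \<not> in_coordinates n v (neighborhood_function G) x"
proof -
  have V: "verts G = v ` {1..n}"
    using assms by (simp add: bij_betw_def)
  show ?thesis
    unfolding neighborhood_function_in_coordinates[OF assms] total_dominating_set_def
      unselected_def V
    by blast
qed

lemma sum_unselected:
  fixes w' :: "'a \<Rightarrow> real"
  assumes "inj_on v {1..n}"
  shows "(\<Sum>u \<in> unselected n v x. w' u) =
    (\<Sum>i=1..n. w' (v i)) - (\<Sum>i=1..n. w' (v i) * of_bool (x i))"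
proof -
  have "(\<Sum>u \<in> unselected n v x. w' u) = (\<Sum>i \<in> {i \<in> {1..n}. \<not> x i}. w' (v i))"
    unfolding unselected_def
    by (subst sum.reindex) (auto intro: inj_on_subset[OF assms])
  also have "\<dots> = (\<Sum>i=1..n. w' (v i) - w' (v i) * of_bool (x i))"
    by (intro sum.mono_neutral_cong_left) auto
  finally show ?thesis
    by (simp add: sum_subtractf)
qed

text \<open>A nonempty graph has a neighborhood, and the all-ones vector selects all of it.\<close>

lemma separating_threshold_less_total_weight:
  assumes "n \<ge> 1" and bij: "bij_betw v {1..n} (verts G)"
    and sep: "separating_structure n (in_coordinates n v (neighborhood_function G)) w t"
  shows "t < (\<Sum>i=1..n. w i)"
proof -
  define x where "x = (\<lambda>i \<in> {1..n}. True)"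
  have "in_coordinates n v (neighborhood_function G) x"
    using \<open>n \<ge> 1\<close> by (auto simp: neighborhood_function_in_coordinates[OF bij] x_def)
  moreover have "x \<in> bool_cube {1..n}"
    by (simp add: x_def bool_cube_def)
  ultimately have "t < (\<Sum>i=1..n. w i * of_bool (x i))"
    using sep by (auto simp: separating_structure_def not_le)
  also have "\<dots> = (\<Sum>i=1..n. w i)"
    by (intro sum.cong) (auto simp: x_def)
  finally show ?thesis .
qed

text \<open>Complementation sends the separating condition at each point of the cube to the domishold
  condition at the complementary vertex set. From left to right, non-negativity of the threshold
  has to be proved, which is where the nonempty vertex set enters.\<close>

lemma separating_structure_iff_total_domishold_structure:
  fixes w' :: "'a \<Rightarrow> real"
  assumes "n \<ge> 1" and bij: "bij_betw v {1..n} (verts G)"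
    and w: "\<forall>i \<in> {1..n}. w' (v i) = w i"
  shows "separating_structure n (in_coordinates n v (neighborhood_function G)) w t \<longleftrightarrow>
    total_domishold_structure G w' ((\<Sum>i=1..n. w i) - t)"
    (is "?sep \<longleftrightarrow> ?dom")
proof -
  let ?W = "\<Sum>i=1..n. w i"
  let ?f = "in_coordinates n v (neighborhood_function G)"
  have V: "verts G = v ` {1..n}" and inj: "inj_on v {1..n}"
    using bij by (auto simp: bij_betw_def)
  have weight: "(\<Sum>u \<in> unselected n v x. w' u) = ?W - (\<Sum>i=1..n. w i * of_bool (x i))" for x
    using w by (simp add: sum_unselected[OF inj])
  have "(\<forall>S \<subseteq> verts G. ?W - t \<le> (\<Sum>u\<in>S. w' u) \<longleftrightarrow> total_dominating_set G S) \<longleftrightarrow>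
      (\<forall>x \<in> bool_cube {1..n}. \<not> ?f x \<longleftrightarrow> (\<Sum>i=1..n. w i * of_bool (x i)) \<le> t)"
    unfolding V all_subsets_iff_all_cube weight total_dominating_unselected_iff[OF bij] by auto
  moreover have "(\<forall>u \<in> verts G. 0 \<le> w' u) \<longleftrightarrow> (\<forall>i \<in> {1..n}. 0 \<le> w i)"
    using w by (simp add: V)
  moreover have "0 \<le> ?W - t" if ?sep
    using separating_threshold_less_total_weight[OF \<open>n \<ge> 1\<close> bij that] by simp
  ultimately show ?thesis
    unfolding separating_structure_def total_domishold_structure_def by blast
qed

theorem proposition4p1:
  fixes G :: "('a, 'b) pre_digraph"
    and v :: "nat \<Rightarrow> 'a"
    and n :: nat
  assumes "graph G"
    and "n \<ge> 1"
    and "bij_betw v {1..n} (verts G)"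
  shows "(total_domishold G \<longleftrightarrow>
            threshold_function n (in_coordinates n v (neighborhood_function G))) \<and>
         (\<forall>(w :: nat \<Rightarrow> real) (t :: real) (w' :: 'a \<Rightarrow> real).
            separating_structure n (in_coordinates n v (neighborhood_function G)) w t \<and>
            integral_structure n w t \<and>
            (\<forall>i \<in> {1..n}. w' (v i) = w i) \<longrightarrow>
            total_domishold_structure G w' ((\<Sum>i=1..n. w i) - t))"
proof -
  let ?f = "in_coordinates n v (neighborhood_function G)"
  note correspondence = separating_structure_iff_total_domishold_structure[OF assms(2,3)]
  have "\<exists>w t. separating_structure n ?f w t" if "total_domishold_structure G w' t'" for w' t'
    \<comment> \<open>The threshold is the one whose complement \<open>W - t\<close> is \<open>t'\<close>.\<close>
    using correspondence[of w' "\<lambda>i. w' (v i)" "(\<Sum>i=1..n. w' (v i)) - t'"] that by auto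
  moreover have "total_domishold G" if "separating_structure n ?f w t" for w t
  proof -
    have "\<forall>i \<in> {1..n}. (w \<circ> inv_into {1..n} v) (v i) = w i"
      using assms(3) by (simp add: bij_betw_def)
    then show ?thesis
      using correspondence that unfolding total_domishold_def by blast
  qed
  ultimately have "total_domishold G \<longleftrightarrow> threshold_function n ?f"
    using neighborhood_function_positive[OF assms(3)]
    unfolding threshold_function_def by (auto simp: total_domishold_def)
  then show ?thesis
    using correspondence by blast
qed

end
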